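(* For $n\geq 5$, the numbers $a_n(321;321)$ satisfy \[ a_n(321;321) = a_{n-1}(321;321) + \binom{\lceil n/2\rceil}{2}, \] where $a_3(321;321)=2$ and $a_4(321;321)=3$. In closed form, \[ a_n(321;321) = \begin{cases} 1 + 2\binom{(n+2)/2}{3} & \text{if } n \text{ is even},\\ 1 + 2\binom{(n+1)/2}{3} + \binom{(n+1)/2}{2} & \text{if } n \text{ is odd}.\end{cases} \]
   Context: $\mathcal{S}_n$ is the set of permutations of $[n]=\{1,\dots,n\}$, written in one-line notation $\pi=\pi_1\pi_2\cdots\pi_n$ with $\pi_i=\pi(i)$. A permutation is cyclic if it consists of exactly one $n$-cycle. For a cyclic $\pi$, its standard cycle notation is $C(\pi)=(c_1,c_2,\dots,c_n)$ with $c_1=1$ and $c_i=\pi_{c_{i-1}}$ for $2\le i\le n$. A sequence of distinct integers $w_1\cdots w_m$ contains a pattern $\sigma\in\mathcal{S}_k$ if there are indices $i_1<\dots<i_k$ with $w_{i_1}\cdots w_{i_k}$ in the same relative order as $\sigma_1\cdots\sigma_k$; otherwise it avoids $\sigma$. For $\sigma,\tau\in\mathcal{S}_3$, $\mathcal{A}_n(\sigma;\tau)$ is the set of cyclic permutations $\pi\in\mathcal{S}_n$ whose one-line notation avoids $\sigma$ and whose cycle notation $C(\pi)$ (as the sequence $c_1c_2\cdots c_n$) avoids $\tau$; $a_n(\sigma;\tau)=|\mathcal{A}_n(\sigma;\tau)|$. *)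

theory Defs
  imports Complex_Main "HOL-Combinatorics.Permutations" "HOL-Combinatorics.Orbits"
begin

text \<open>
  Permutations of \<open>[n]\<close> are functions \<open>p\<close> on the naturals with \<open>p permutes {1..n}\<close>,
  i.e. bijections of \<open>{1..n}\<close> extended by the identity. Such a permutation consists of
  exactly one \<open>n\<close>-cycle iff \<open>{1..n}\<close> is a single orbit of \<open>p\<close>, i.e. \<open>cyclic_on p {1..n}\<close>.
\<close>

definition one_line :: "nat \<Rightarrow> (nat \<Rightarrow> nat) \<Rightarrow> nat list" where
  "one_line n p = map p [1..<n + 1]"

text \<open>The list \<open>c\<^sub>1, \<dots>, c\<^sub>n\<close> with \<open>c\<^sub>1 = 1\<close> and \<open>c\<^sub>i = p c\<^sub>i\<^sub>-\<^sub>1\<close>, so \<open>c\<^sub>i = p\<^sup>i\<^sup>-\<^sup>1 1\<close>.\<close>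

definition cycle_notation :: "nat \<Rightarrow> (nat \<Rightarrow> nat) \<Rightarrow> nat list" where
  "cycle_notation n p = map (\<lambda>i. (p ^^ i) 1) [0..<n]"

definition contains_pattern :: "nat list \<Rightarrow> nat list \<Rightarrow> bool" where
  "contains_pattern w \<sigma> \<longleftrightarrow>
     (\<exists>f :: nat \<Rightarrow> nat. strict_mono_on {..<length \<sigma>} f \<and>
        (\<forall>j < length \<sigma>. f j < length w) \<and>
        (\<forall>i < length \<sigma>. \<forall>j < length \<sigma>. w ! f i < w ! f j \<longleftrightarrow> \<sigma> ! i < \<sigma> ! j))"

definition avoids :: "nat list \<Rightarrow> nat list \<Rightarrow> bool" where
  "avoids w \<sigma> \<longleftrightarrow> \<not> contains_pattern w \<sigma>"

definition cyc_avoiders :: "nat \<Rightarrow> nat list \<Rightarrow> nat list \<Rightarrow> (nat \<Rightarrow> nat) set" where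
  "cyc_avoiders n \<sigma> \<tau> =
     {p. p permutes {1..n} \<and> cyclic_on p {1..n} \<and>
         avoids (one_line n p) \<sigma> \<and> avoids (cycle_notation n p) \<tau>}"

definition num_cyc_avoiders :: "nat \<Rightarrow> nat list \<Rightarrow> nat list \<Rightarrow> nat" where
  "num_cyc_avoiders n \<sigma> \<tau> = card (cyc_avoiders n \<sigma> \<tau>)"

end

theory Submission
  imports Defs
begin

text \<open>
  Sort the avoiding permutations by \<open>p 1\<close>. Those with \<open>p 1 = 2\<close> arise by putting a new
  \<open>1\<close> in front of the cycle notation of a permutation of \<open>[n - 1]\<close>. If \<open>p 1 \<ge> 3\<close>,
  then either \<open>p 1 = 3\<close> and \<open>p 2 = 4\<close>, and deleting \<open>1\<close> and \<open>2\<close> from the cycle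
  gives a permutation of \<open>[n - 2]\<close> that again maps \<open>1\<close> to at least \<open>3\<close>; or
  the cycle ends in \<open>p 1 - 1\<close>, and then it is
  \<open>(1, m + 2, 2, m + 3, \<dots>, m, 2m + 1, 2m + 2, \<dots>, n, m + 1)\<close> with \<open>m = p 1 - 2\<close>.
  Hence the number \<open>b\<^sub>n\<close> of permutations with \<open>p 1 \<ge> 3\<close> satisfies
  \<open>b\<^sub>n = b\<^sub>n\<^sub>-\<^sub>2 + \<lfloor>(n - 1) / 2\<rfloor>\<close>, that is, \<open>b\<^sub>n\<close> is the binomial coefficient of
  \<open>\<lceil>n / 2\<rceil>\<close> over \<open>2\<close>, and \<open>a\<^sub>n = a\<^sub>n\<^sub>-\<^sub>1 + b\<^sub>n\<close>.
\<close>

section \<open>Occurrences of 321 as inequalities\<close>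

definition no321 :: "nat \<Rightarrow> (nat \<Rightarrow> nat) \<Rightarrow> bool" where
  "no321 n f \<longleftrightarrow> \<not> (\<exists>x y z. 1 \<le> x \<and> x < y \<and> y < z \<and> z \<le> n \<and> f x > f y \<and> f y > f z)"

lemma avoids_321_iff:
  "avoids w [3, 2, 1] \<longleftrightarrow> \<not> (\<exists>i j k. i < j \<and> j < k \<and> k < length w \<and> w ! i > w ! j \<and> w ! j > w ! k)"
proof -
  have "contains_pattern w [3, 2, 1] \<longleftrightarrow>
      (\<exists>i j k. i < j \<and> j < k \<and> k < length w \<and> w ! i > w ! j \<and> w ! j > w ! k)" (is "?L \<longleftrightarrow> ?R")
  proof
    assume ?L
    then obtain f where f: "strict_mono_on {..<3::nat} f" "\<forall>j<3. f j < length w"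
      "\<forall>i<3. \<forall>j<3. w ! f i < w ! f j \<longleftrightarrow> [3,2,1::nat] ! i < [3,2,1] ! j"
      unfolding contains_pattern_def by (auto simp: numeral_3_eq_3)
    have "f 0 < f 1" "f 1 < f 2" using f(1) by (auto simp: strict_mono_on_def)
    moreover have "w ! f 1 < w ! f 0" using f(3)[rule_format, of 1 0] by simp
    moreover have "w ! f 2 < w ! f 1" using f(3)[rule_format, of 2 1] by simp
    moreover have "f 2 < length w" using f(2) by simp
    ultimately show ?R by blast
  next
    assume ?R
    then obtain i j k where h: "i < j" "j < k" "k < length w" "w ! i > w ! j" "w ! j > w ! k"
      by blast
    define f where "f = (\<lambda>m::nat. if m = 0 then i else if m = 1 then j else k)"
    have "strict_mono_on {..<length [3,2,1::nat]} f"
      using h by (auto simp: strict_mono_on_def f_def)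
    moreover have "\<forall>m < length [3,2,1::nat]. f m < length w"
      using h by (auto simp: f_def)
    moreover have "\<forall>a < length [3,2,1::nat]. \<forall>b < length [3,2,1::nat].
        w ! f a < w ! f b \<longleftrightarrow> [3,2,1::nat] ! a < [3,2,1] ! b"
      using h by (auto simp: f_def less_Suc_eq)
    ultimately show ?L unfolding contains_pattern_def by blast
  qed
  thus ?thesis by (simp add: avoids_def)
qed

lemma avoids_one_line_iff: "avoids (one_line n p) [3, 2, 1] \<longleftrightarrow> no321 n p"
proof -
  have nth: "one_line n p ! i = p (Suc i)" if "i < n" for i
    using that by (simp add: one_line_def nth_upt del: upt_Suc)
  have len: "length (one_line n p) = n" by (simp add: one_line_def)
  show ?thesis unfolding avoids_321_iff no321_def len
  proof (intro arg_cong[where f = Not] iffI; elim exE conjE)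
    fix i j k
    assume "i < j" "j < k" "k < n" "one_line n p ! j < one_line n p ! i"
      "one_line n p ! k < one_line n p ! j"
    thus "\<exists>x y z. 1 \<le> x \<and> x < y \<and> y < z \<and> z \<le> n \<and> p y < p x \<and> p z < p y"
      by (intro exI[of _ "Suc i"] exI[of _ "Suc j"] exI[of _ "Suc k"]) (simp add: nth)
  next
    fix x y z
    assume "1 \<le> x" "x < y" "y < z" "z \<le> n" "p y < p x" "p z < p y"
    thus "\<exists>i j k. i < j \<and> j < k \<and> k < n \<and> one_line n p ! j < one_line n p ! i \<and>
        one_line n p ! k < one_line n p ! j"
      using nth[of "x - 1"] nth[of "y - 1"] nth[of "z - 1"]
      by (intro exI[of _ "x - 1"] exI[of _ "y - 1"] exI[of _ "z - 1"]) (simp; linarith)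
  qed
qed

section \<open>Positions along a cycle\<close>

text \<open>
  \<open>d v\<close> is the 0-based position of \<open>v\<close> in the cycle notation. Since 321 is its own inverse,
  the cycle notation avoids 321 iff its inverse \<open>d\<close> does.
\<close>

locale cycle_pos =
  fixes n :: nat and p d :: "nat \<Rightarrow> nat"
  assumes n_pos: "1 \<le> n" and perm: "p permutes {1..n}" and d1: "d 1 = 0"
    and d_step: "\<And>v. \<lbrakk>1 \<le> v; v \<le> n; p v \<noteq> 1\<rbrakk> \<Longrightarrow> d (p v) = Suc (d v)"
begin

lemma p_range: "1 \<le> v \<Longrightarrow> v \<le> n \<Longrightarrow> 1 \<le> p v \<and> p v \<le> n"
  using permutes_in_image[OF perm, of v] by auto

lemma p_inj: "p u = p v \<Longrightarrow> u = v"
  using permutes_inj[OF perm] by (simp add: inj_eq)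

lemma pre: assumes "1 \<le> v" "v \<le> n" obtains u where "1 \<le> u" "u \<le> n" "p u = v"
proof -
  have "v \<in> p ` {1..n}" using assms permutes_image[OF perm] by simp
  thus ?thesis using that by auto
qed

lemma pre_step:
  assumes "2 \<le> v" "v \<le> n" obtains u where "1 \<le> u" "u \<le> n" "p u = v" "d v = Suc (d u)"
proof -
  obtain u where u: "1 \<le> u" "u \<le> n" "p u = v" using assms pre[of v] by auto
  thus ?thesis using that d_step[of u] assms by auto
qed

lemma d_pos: "2 \<le> v \<Longrightarrow> v \<le> n \<Longrightarrow> 0 < d v"
  by (metis pre_step zero_less_Suc)

text \<open>Passing to the preimage lowers \<open>d\<close> by one and can stop only at 1, because
  every other element of [n] has a positive position. So \<open>d v\<close> really counts the
  applications of \<open>p\<close> leading from 1 to \<open>v\<close>.\<close>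

lemma funpow_d: "1 \<le> v \<Longrightarrow> v \<le> n \<Longrightarrow> (p ^^ d v) 1 = v"
proof (induction "d v" arbitrary: v)
  case 0
  hence "v = 1" using d_pos[of v] by (cases "2 \<le> v") auto
  thus ?case using d1 by simp
next
  case (Suc m)
  have "v \<noteq> 1" using Suc.hyps(2) d1 by auto
  then obtain u where u: "1 \<le> u" "u \<le> n" "p u = v" "d v = Suc (d u)"
    using pre_step[of v] Suc.prems by (metis One_nat_def Suc_1 le_antisym not_less_eq_eq)
  thus ?case using Suc.hyps(1)[of u] Suc.hyps(2) by simp
qed

lemma d_inj: "\<lbrakk>1 \<le> u; u \<le> n; 1 \<le> v; v \<le> n; d u = d v\<rbrakk> \<Longrightarrow> u = v"
  by (metis funpow_d)

text \<open>Walking back from \<open>v\<close> to 1 meets every smaller position. A function on n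
  elements thus takes \<open>d v + 1\<close> distinct values, which gives the bound in
  \<open>d_less\<close>.\<close>

lemma d_image_downward: "1 \<le> v \<Longrightarrow> v \<le> n \<Longrightarrow> {..d v} \<subseteq> d ` {1..n}"
proof (induction "d v" arbitrary: v)
  case 0
  thus ?case by auto
next
  case (Suc m)
  have "v \<noteq> 1" using Suc.hyps(2) d1 by auto
  then obtain u where u: "1 \<le> u" "u \<le> n" "p u = v" "d v = Suc (d u)"
    using pre_step[of v] Suc.prems by (metis One_nat_def Suc_1 le_antisym not_less_eq_eq)
  hence "{..d u} \<subseteq> d ` {1..n}" using Suc.hyps by simp
  moreover have "{..d v} = insert (d v) {..d u}" using u by auto
  ultimately show ?case using Suc.prems by auto
qed

lemma d_less: assumes "1 \<le> v" "v \<le> n" shows "d v < n"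
proof -
  have "card {..d v} \<le> card (d ` {1..n})"
    using d_image_downward[OF assms] by (intro card_mono) auto
  also have "\<dots> \<le> n" using card_image_le[of "{1..n}" d] by simp
  finally show ?thesis by simp
qed

lemma d_bij: "bij_betw d {1..n} {..<n}"
proof -
  have i: "inj_on d {1..n}" using d_inj by (auto simp: inj_on_def)
  have "d ` {1..n} = {..<n}"
    using d_less card_image[OF i] by (intro card_subset_eq) auto
  thus ?thesis using i by (simp add: bij_betw_def)
qed

lemma d_le_last: assumes l: "1 \<le> l" "l \<le> n" "p l = 1" and v: "1 \<le> v" "v \<le> n" shows "d v \<le> d l"
proof -
  obtain w where w: "w \<in> {1..n}" "d w = n - 1"
    using d_bij n_pos unfolding bij_betw_def
    by (metis diff_less imageE lessThan_iff less_eq_Suc_le less_numeral_extra(1) One_nat_def)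
  \<comment> \<open>Otherwise the successor of the entry at position n - 1 would sit at position n,
    against \<open>d_less\<close>.\<close>
  have "p w = 1"
  proof (rule ccontr)
    assume "p w \<noteq> 1"
    hence "d (p w) = n" using d_step[of w] w n_pos by simp
    thus False using d_less[of "p w"] p_range[of w] w by auto
  qed
  hence "w = l" using p_inj[of w l] l by simp
  thus ?thesis using w d_less[OF v] by simp
qed

text \<open>A position function already forces a single cycle, since it makes every element of [n]
  reachable from 1. The permutations constructed below therefore come with an explicit
  \<open>d\<close>.\<close>

lemma cyclic: "cyclic_on p {1..n}"
proof -
  have perm': "permutation p" using perm by (auto simp: permutation_permutes)
  have "orbit p 1 = {1..n}"
  proof
    show "orbit p 1 \<subseteq> {1..n}"
    proof
      fix x assume "x \<in> orbit p 1"
      thus "x \<in> {1..n}" by induction (use n_pos p_range in auto)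
    qed
    show "{1..n} \<subseteq> orbit p 1"
    proof
      fix x assume "x \<in> {1..n}"
      hence "(p ^^ d x) 1 = x" using funpow_d by simp
      moreover have "(p ^^ d x) 1 \<in> orbit p 1"
        using permutation_self_in_orbit[OF perm'] by (intro funpow_in_orbit) auto
      ultimately show "x \<in> orbit p 1" by simp
    qed
  qed
  thus ?thesis using n_pos unfolding cyclic_on_def by (intro bexI[of _ 1]) auto
qed

lemma avoids_cycle_iff: "avoids (cycle_notation n p) [3, 2, 1] \<longleftrightarrow> no321 n d"
proof -
  have nth: "cycle_notation n p ! i = (p ^^ i) 1" if "i < n" for i
    using that by (simp add: cycle_notation_def)
  have nthd: "cycle_notation n p ! d v = v" if "1 \<le> v" "v \<le> n" for v
    using that funpow_d d_less nth by simp
  have len: "length (cycle_notation n p) = n" by (simp add: cycle_notation_def)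
  have surj: "\<exists>v\<ge>1. v \<le> n \<and> d v = i" if "i < n" for i
  proof -
    have "i \<in> d ` {1..n}" using that d_bij by (simp add: bij_betw_def)
    thus ?thesis by auto
  qed
  show ?thesis unfolding avoids_321_iff no321_def len
  proof (intro arg_cong[where f = Not] iffI; elim exE conjE)
    fix i j k
    assume h: "i < j" "j < k" "k < n" "cycle_notation n p ! j < cycle_notation n p ! i"
      "cycle_notation n p ! k < cycle_notation n p ! j"
    \<comment> \<open>Inversion reverses the roles: falling values at positions i < j < k are rising
      values with falling positions, so the smallest value x sits at k and the largest value z at
      i.\<close>
    obtain x where x: "1 \<le> x" "x \<le> n" "d x = k" using surj[of k] h by auto
    obtain y where y: "1 \<le> y" "y \<le> n" "d y = j" using surj[of j] h by auto
    obtain z where z: "1 \<le> z" "z \<le> n" "d z = i" using surj[of i] h by auto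
    have "x < y" "y < z" using h x y z nthd by auto
    thus "\<exists>x y z. 1 \<le> x \<and> x < y \<and> y < z \<and> z \<le> n \<and> d y < d x \<and> d z < d y"
      using x y z h by blast
  next
    fix x y z
    assume h: "1 \<le> x" "x < y" "y < z" "z \<le> n" "d y < d x" "d z < d y"
    thus "\<exists>i j k. i < j \<and> j < k \<and> k < n \<and> cycle_notation n p ! j < cycle_notation n p ! i \<and>
        cycle_notation n p ! k < cycle_notation n p ! j"
      using nthd[of x] nthd[of y] nthd[of z] d_less[of x]
      by (intro exI[of _ "d z"] exI[of _ "d y"] exI[of _ "d x"]) simp
  qed
qed

end

lemma cyclic_obtain_pos:
  assumes "1 \<le> n" "p permutes {1..n}" "cyclic_on p {1..n}"
  obtains d where "cycle_pos n p d"
proof -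
  have orb: "orbit p 1 = {1..n}" using assms orbit_cyclic_eq3 by fastforce
  have perm': "permutation p" using assms by (auto simp: permutation_permutes)
  have s1: "1 \<in> orbit p 1" using orb assms by simp
  \<comment> \<open>The least number of steps from 1. Cancelling the last step by injectivity gives
    one inequality of \<open>d_step\<close>, appending a step gives the other.\<close>
  define d where "d = funpow_dist p 1"
  have "cycle_pos n p d"
  proof
    show "d 1 = 0" by (simp add: d_def funpow_dist_0)
  next
    fix v assume v: "1 \<le> v" "v \<le> n" "p v \<noteq> 1"
    hence vo: "v \<in> orbit p 1" using orb by simp
    have "(p ^^ d v) 1 = v" using funpow_dist_prop[OF vo] by (simp add: d_def)
    hence 1: "(p ^^ Suc (d v)) 1 = p v" by simp
    have pvo: "p v \<in> orbit p 1" using vo by (rule orbit.step)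
    have 2: "(p ^^ d (p v)) 1 = p v" using funpow_dist_prop[OF pvo] by (simp add: d_def)
    have "d (p v) \<noteq> 0" using 2 v by (metis funpow_0)
    then obtain m where m: "d (p v) = Suc m" by (cases "d (p v)") auto
    have "p ((p ^^ m) 1) = p v" using 2 m by simp
    hence "(p ^^ m) 1 = v" using permutes_inj[OF assms(2)] by (simp add: inj_eq)
    hence "d v \<le> m" unfolding d_def funpow_dist_def by (rule Least_le)
    moreover have "d (p v) \<le> Suc (d v)"
      using 1 unfolding d_def funpow_dist_def by (intro Least_le)
    ultimately show "d (p v) = Suc (d v)" using m by simp
  qed (use assms in auto)
  thus ?thesis using that by blast
qed

locale avoider = cycle_pos +
  assumes p_no321: "no321 n p" and d_no321: "no321 n d"
begin

lemma p_321: "\<lbrakk>p z < p y; p y < p x; x < y; y < z; 1 \<le> x; z \<le> n\<rbrakk> \<Longrightarrow> False"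
  using p_no321 unfolding no321_def by blast

lemma d_321: "\<lbrakk>d z < d y; d y < d x; x < y; y < z; 1 \<le> x; z \<le> n\<rbrakk> \<Longrightarrow> False"
  using d_no321 unfolding no321_def by blast

end

lemma cyc_avoiders_321:
  assumes "1 \<le> n"
  shows "cyc_avoiders n [3, 2, 1] [3, 2, 1] = {p. \<exists>d. avoider n p d}"
proof (intro set_eqI iffI)
  fix p assume "p \<in> cyc_avoiders n [3, 2, 1] [3, 2, 1]"
  hence p: "p permutes {1..n}" "cyclic_on p {1..n}" "avoids (one_line n p) [3, 2, 1]"
    "avoids (cycle_notation n p) [3, 2, 1]" by (auto simp: cyc_avoiders_def)
  obtain d where d: "cycle_pos n p d" using cyclic_obtain_pos[OF assms p(1,2)] .
  hence "avoider n p d"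
    using cycle_pos.avoids_cycle_iff[OF d] p avoids_one_line_iff
    by (auto simp: avoider_def avoider_axioms_def)
  thus "p \<in> {p. \<exists>d. avoider n p d}" by blast
next
  fix p assume "p \<in> {p. \<exists>d. avoider n p d}"
  then obtain d where "avoider n p d" by blast
  then interpret avoider n p d .
  show "p \<in> cyc_avoiders n [3, 2, 1] [3, 2, 1]"
    using perm cyclic avoids_cycle_iff avoids_one_line_iff p_no321 d_no321
    by (auto simp: cyc_avoiders_def)
qed

section \<open>The two shapes for \<open>p 1\<close> at least 3\<close>

context avoider
begin

text \<open>With k = p 1, let l be the last entry of the cycle and q, y the entries before and after
  2. If 2 is last, then k = 3. Otherwise k = 3 forces y = 4, and k >= 4 forces q = k, whence l = k -
  1. Every contradiction is a 321 in \<open>p\<close> or in the cycle.\<close>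

lemma dichotomy:
  assumes k3: "3 \<le> p 1"
  shows "(p 1 = 3 \<and> p 2 = 4) \<or> p (p 1 - 1) = 1"
proof -
  define k where "k = p 1"
  have kn: "3 \<le> k" "k \<le> n" using k3 p_range[of 1] n_pos by (auto simp: k_def)
  have dk: "d k = 1" using d_step[of 1] k3 d1 n_pos by (simp add: k_def)
  obtain l where l: "1 \<le> l" "l \<le> n" "p l = 1" using pre[of 1] n_pos by auto
  obtain q where q: "1 \<le> q" "q \<le> n" "p q = 2" "d 2 = Suc (d q)" using pre_step[of 2] kn by auto
  have l1: "l \<noteq> 1" "q \<noteq> 1" "l \<noteq> q" using l q k3 by auto
  \<comment> \<open>Otherwise the places 1 < q < l carry k > 2 > 1.\<close>
  have lq: "l < q"
  proof (rule ccontr)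
    assume "\<not> l < q"
    thus False using p_321[of l q 1] l q l1 k3 by auto
  qed
  \<comment> \<open>These entries all come after k in the cycle, so a descent among them would
    complete a 321 starting with k.\<close>
  have small: "d x < d y" if "2 \<le> x" "x < y" "y < k" for x y
  proof (rule ccontr)
    assume "\<not> d x < d y"
    moreover have "d x \<noteq> d y" using d_inj[of x y] that kn by auto
    ultimately have "d y < d x" by simp
    moreover have "d y > 1"
      using d_pos[of y] that kn dk d_inj[of y k] by (cases "d y = 1") auto
    ultimately show False using d_321[of k y x] that kn dk by simp
  qed
  have dlast: "d v \<le> d l" if "1 \<le> v" "v \<le> n" for v using d_le_last[OF l that] .
  show ?thesis
  proof (cases "l = 2")
    case True
    have "k = 3"
      using small[of 2 3] dlast[of 3] True kn by (cases "3 < k") auto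
    thus ?thesis using True l by (auto simp: k_def)
  next
    case False
    hence l3: "3 \<le> l" using l l1 by auto
    have q4: "4 \<le> q" using l3 lq by simp
    define y where "y = p 2"
    have y: "y \<noteq> 1" "1 \<le> y" "y \<le> n" "y \<noteq> 2" "y \<noteq> k"
      using p_inj[of 2 l] p_inj[of 2 q] p_inj[of 2 1] False l q q4 p_range[of 2] kn by (auto simp: y_def k_def)
    have dy: "d y = Suc (d 2)" using d_step[of 2] y kn by (simp add: y_def)
    \<comment> \<open>Here 2 itself would complete a descent to a 321. Since q stands directly
      before 2, it is the largest entry preceding 2.\<close>
    have before2: "a < b" if "3 \<le> a" "3 \<le> b" "a \<le> n" "b \<le> n" "d a < d b" "d b < d 2" for a b
      using d_321[of a b 2] that by (cases "a = b") (auto simp: not_less[symmetric] intro: ccontr)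
    have dq1: "d k \<le> d q"
      using d_pos[of q] q4 q dk by simp
    have next_k: "d (p k) = 2" if "k \<noteq> l"
    proof -
      have "p k \<noteq> 1" using that l p_inj[of k l] by auto
      thus ?thesis using d_step[of k] kn dk by simp
    qed
    have less_q: "a \<le> q" if "3 \<le> a" "a \<le> n" "d a \<le> d q" for a
    proof (cases "d a = d q")
      case True
      thus ?thesis using d_inj[of a q] that q by simp
    next
      case False
      thus ?thesis using before2[of a q] that q q4 by simp
    qed
    have pk_less_q: "p k \<le> q" if "k \<noteq> l" "k \<noteq> q"
    proof -
      have "p k \<noteq> 1" "p k \<noteq> 2" using that l q p_inj[of k l] p_inj[of k q] by auto
      moreover have "1 \<le> p k" "p k \<le> n" using p_range[of k] kn by auto
      moreover have "d k \<noteq> d q" using d_inj[of k q] that kn q by auto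
      ultimately show ?thesis using less_q[of "p k"] next_k that dq1 dk by simp
    qed
    show ?thesis
    proof (cases "k = 3")
      case True
      have "y = 4"
      proof (rule ccontr)
        assume "y \<noteq> 4"
        hence y5: "5 \<le> y" using y True by auto
        have kl: "k \<noteq> l"
          using dlast[of q] dlast[of 2] q dk dq1 kn by auto
        have l4: "4 \<le> l" using kl True l3 by simp
        have pk: "p k \<noteq> 1" "p k \<noteq> 2 \<or> k = q" "1 \<le> p k" "p k \<le> n"
          using l q p_inj[of k l] kl p_inj[of k q] p_range[of k] kn by auto
        \<comment> \<open>If 4 preceded 2, the increase before 2 would put 4 directly after 3, and
          the places 2 < 3 < l would carry y > 4 > 1.\<close>
        have d42: "d 2 < d 4"
        proof (rule ccontr)
          assume "\<not> d 2 < d 4"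
          moreover have "d 4 \<noteq> d 2" using d_inj[of 4 2] l4 l by auto
          ultimately have a: "d 4 < d 2" by simp
          have kq: "k \<noteq> q" using True q4 by simp
          have d4: "2 \<le> d 4" 
            using d_pos[of 4] dk d_inj[of 4 k] l4 l True by (cases "d 4 = 1") auto
          have "p k \<noteq> 3" using next_k[OF kl] dk True by auto
          hence p3: "4 \<le> p k" using pk kq by auto
          have "p k = 4"
          proof (rule ccontr)
            assume "p k \<noteq> 4"
            hence "4 < p k" using p3 by simp
            moreover have "d (p k) \<noteq> d 4" using d_inj[of "p k" 4] \<open>p k \<noteq> 4\<close> pk l4 l by auto
            ultimately show False using before2[of "p k" 4] next_k[OF kl] d4 a pk l4 l by auto
          qed
          thus False using p_321[of l k 2] True y5 l4 l by (simp add: y_def)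
        qed
        \<comment> \<open>Otherwise q, y, 4 is a 321 in the cycle: y directly follows 2, so 4 comes
          after y.\<close>
        have "q < y"
        proof (rule ccontr)
          assume "\<not> q < y"
          moreover have "q \<noteq> y" using dy q(4) by auto
          ultimately have "y < q" by simp
          moreover have "d y < d 4"
          proof -
            have "d y \<noteq> d 4" using d_inj[of y 4] y \<open>y \<noteq> 4\<close> l4 l by auto
            thus ?thesis using d42 dy by simp
          qed
          ultimately show False using d_321[of q y 4] y5 q dy by simp
        qed
        moreover have "k \<noteq> q" using True q4 by simp
        \<comment> \<open>The places 2 < 3 < l now carry y > p 3 > 1.\<close>
        ultimately have "p k < y" using pk_less_q kl by simp
        thus False using p_321[of l k 2] True l4 l pk by (simp add: y_def)
      qed
      thus ?thesis using True by (simp add: y_def k_def)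
    next
      case False
      hence k4: "4 \<le> k" using kn by simp
      have d23: "d 2 < d 3" using small[of 2 3] k4 by simp
      \<comment> \<open>If not, then k < q because k precedes 2. As before q < y, now with 3 in
        place of 4, so the places 2 < k < q carry y > p k > 2.\<close>
      have qk: "q = k"
      proof (rule ccontr)
        assume neq: "q \<noteq> k"
        have qgk: "k < q" using less_q[of k] kn dq1 neq by simp
        have kl: "k \<noteq> l" using lq qgk dlast[of 3] d23 q dk dq1 kn by auto
        have yk: "k < y"
        proof (rule ccontr)
          assume "\<not> k < y"
          thus False using p_321[of q 2 1] y q q4 by (simp add: y_def k_def)
        qed
        have "q < y"
        proof (rule ccontr)
          assume "\<not> q < y"
          moreover have "q \<noteq> y" using dy q(4) by auto
          ultimately have "y < q" by simp
          moreover have "d y < d 3"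
            using d_inj[of y 3] yk k4 y d23 dy kn by (cases "d y = d 3") auto
          ultimately show False using d_321[of q y 3] yk k4 q dy by simp
        qed
        hence "p k < y" using pk_less_q kl neq by fastforce
        moreover have "2 < p k"
          using p_inj[of k l] p_inj[of k q] l q kl neq p_range[of k] kn by (cases "p k = 1"; cases "p k = 2") auto
        ultimately show False using p_321[of q k 2] kn qgk q by (simp add: y_def)
      qed
      \<comment> \<open>Now 3 <= l < k, and by \<open>small\<close> the entry k - 1 comes latest
        among those below k.\<close>
      have "l = k - 1"
      proof (rule ccontr)
        assume "l \<noteq> k - 1"
        hence "l < k - 1" using lq qk by simp
        moreover have "k - 1 \<le> n" using kn by linarith
        ultimately show False using small[of l "k - 1"] dlast[of "k - 1"] l3 kn by simp
      qed
      thus ?thesis using l by (simp add: k_def)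
    qed
  qed
qed

end

section \<open>The staircase family\<close>

text \<open>
  The permutation with cycle \<open>(1, m + 2, 2, m + 3, \<dots>, m, 2m + 1, 2m + 2, \<dots>, n, m + 1)\<close>,
  for \<open>1 \<le> m\<close> and \<open>2m + 1 \<le> n\<close>.
\<close>

definition stair :: "nat \<Rightarrow> nat \<Rightarrow> nat \<Rightarrow> nat" where
  "stair n m v =
     (if v = 0 \<or> n < v then v
      else if v \<le> m then m + 1 + v
      else if v = m + 1 then 1
      else if v \<le> 2 * m then v - m
      else if v < n then v + 1
      else m + 1)"

text \<open>The entries 1, ..., m take the even and m + 2, ..., 2m + 1 the odd positions below 2m.
  Later entries sit at \<open>v - 2\<close> because m + 1 has moved to the end.\<close>

definition stair_pos :: "nat \<Rightarrow> nat \<Rightarrow> nat \<Rightarrow> nat" where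
  "stair_pos n m v =
     (if v \<le> m then 2 * (v - 1)
      else if v = m + 1 then n - 1
      else if v \<le> 2 * m + 1 then 2 * v - 2 * m - 3
      else v - 2)"

lemma permutes_intervalI:
  fixes f :: "nat \<Rightarrow> nat"
  assumes "\<And>v. 1 \<le> v \<Longrightarrow> v \<le> n \<Longrightarrow> 1 \<le> f v \<and> f v \<le> n"
    and "\<And>u v. \<lbrakk>1 \<le> u; u < v; v \<le> n\<rbrakk> \<Longrightarrow> f u \<noteq> f v"
    and "\<And>v. v = 0 \<or> n < v \<Longrightarrow> f v = v"
  shows "f permutes {1..n}"
proof (rule bij_imp_permutes)
  have i: "inj_on f {1..n}" using assms(2) by (intro linorder_inj_onI) auto
  moreover have "f ` {1..n} = {1..n}"
    using assms(1) by (intro endo_inj_surj[OF _ _ i]) auto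
  ultimately show "bij_betw f {1..n} {1..n}" by (simp add: bij_betw_def)
next
  fix v assume "v \<notin> {1..n}"
  thus "f v = v" using assms(3)[of v] by auto
qed

text \<open>Both functions are unions of two increasing sequences, and two of any three arguments
  share a class, so 321 cannot occur. The classes are the exceedances and the rest for
  \<open>stair\<close>, and the arguments up to m + 1 and beyond for
  \<open>stair_pos\<close>.\<close>

lemma avoider_stair:
  assumes "1 \<le> m" "2 * m + 1 \<le> n"
  shows "avoider n (stair n m) (stair_pos n m)"
proof
  show "1 \<le> n" using assms by simp
  show "stair n m permutes {1..n}"
    by (rule permutes_intervalI) (use assms in \<open>auto simp: stair_def\<close>)
  show "stair_pos n m 1 = 0" using assms by (simp add: stair_pos_def)
next
  fix v assume "1 \<le> v" "v \<le> n" "stair n m v \<noteq> 1"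
  thus "stair_pos n m (stair n m v) = Suc (stair_pos n m v)"
    using assms by (auto simp: stair_def stair_pos_def)
next
  have up: "stair n m u < stair n m v" if "1 \<le> u" "u < v" "v \<le> n"
    "(u \<le> m \<or> (2 * m < u \<and> u < n)) = (v \<le> m \<or> (2 * m < v \<and> v < n))" for u v
    using that assms by (auto simp: stair_def)
  show "no321 n (stair n m)"
    unfolding no321_def
  proof (intro notI, elim exE conjE)
    fix x y z assume h: "1 \<le> x" "x < y" "y < z" "z \<le> n"
      "stair n m y < stair n m x" "stair n m z < stair n m y"
    show False using up[of x y] up[of y z] up[of x z] h by linarith
  qed
  have up': "stair_pos n m u < stair_pos n m v" if "1 \<le> u" "u < v" "v \<le> n"
    "(u \<le> m + 1) = (v \<le> m + 1)" for u v
    using that assms by (auto simp: stair_pos_def)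
  show "no321 n (stair_pos n m)"
    unfolding no321_def
  proof (intro notI, elim exE conjE)
    fix x y z assume h: "1 \<le> x" "x < y" "y < z" "z \<le> n"
      "stair_pos n m y < stair_pos n m x" "stair_pos n m z < stair_pos n m y"
    show False using up'[of x y] up'[of y z] up'[of x z] h by linarith
  qed
qed

text \<open>As m + 2 is second and m + 1 last in the cycle, avoidance makes the cycle a shuffle of
  the increasing runs 1, ..., m + 1 and m + 2, ..., n. Avoidance in \<open>p\<close> makes the runs
  alternate until only m + 1 is left of the small one.\<close>

lemma (in avoider) eq_stair:
  assumes m: "1 \<le> m" "p 1 = m + 2" "p (m + 1) = 1"
  shows "2 * m + 1 \<le> n \<and> p = stair n m"
proof -
  have kn: "m + 2 \<le> n" using p_range[of 1] n_pos m by simp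
  have dk: "d (m + 2) = 1" using d_step[of 1] m d1 n_pos by simp
  have dlast: "d v < d (m + 1)" if "1 \<le> v" "v \<le> n" "v \<noteq> m + 1" for v
    using d_le_last[of "m + 1" v] d_inj[of v "m + 1"] that m kn by (cases "d v = d (m + 1)") auto
  have big: "d v < d w" if "m + 2 \<le> v" "v < w" "w \<le> n" for v w
  proof (rule ccontr)
    assume "\<not> d v < d w"
    hence "d w < d v" using d_inj[of v w] that by (cases "d v = d w") auto
    thus False using d_321[of w v "m + 1"] dlast[of v] that by simp
  qed
  have small: "d v < d w" if "1 \<le> v" "v < w" "w \<le> m + 1" for v w
  proof (rule ccontr)
    assume "\<not> d v < d w"
    hence lt: "d w < d v" using d_inj[of v w] that kn by (cases "d v = d w") auto
    hence "w \<noteq> m + 1" using dlast[of v] that kn by auto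
    moreover have "1 < d w" using d_pos[of w] d_inj[of w "m + 2"] dk that kn by (cases "d w = 1") auto
    ultimately show False using d_321[of "m + 2" w v] lt dk that kn by simp
  qed
  \<comment> \<open>Otherwise the places 1 < u < m + 1 carry m + 2 > p u > 1. So each of 1, ..., m
    is followed by a large entry.\<close>
  have p_small: "m + 2 \<le> p u" if "1 \<le> u" "u \<le> m" for u
  proof (rule ccontr)
    assume a: "\<not> m + 2 \<le> p u"
    hence "u \<noteq> 1" using m by auto
    moreover have "p u \<noteq> 1" using p_inj[of u "m + 1"] m that by auto
    ultimately show False using p_321[of "m + 1" u 1] p_range[of u] that kn m a by simp
  qed
  have not_between: "w \<le> i \<or> m + 1 < w" if "1 \<le> w" "i \<le> m" "1 \<le> i" "d w < d (i + 1)" for w i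
  proof (rule ccontr)
    assume "\<not> (w \<le> i \<or> m + 1 < w)"
    thus False using small[of "i + 1" w] that by (cases "w = i + 1") auto
  qed
  have adv: "p (m + 1 + i) = i + 1 \<and> p (i + 1) = m + 2 + i"
    if i: "1 \<le> i" "i < m" "p i = m + 1 + i" for i
  proof -
    define y where "y = m + 1 + i"
    have y: "y \<le> n" "d y = Suc (d i)"
      using p_range[of i] d_step[of i] i kn by (auto simp: y_def)
    obtain r where r: "1 \<le> r" "r \<le> n" "p r = i + 1" "d (i + 1) = Suc (d r)"
      using pre_step[of "i + 1"] i kn by auto
    have rbig: "m + 2 \<le> r"
      using p_small[of r] r i m by (cases "r = m + 1"; cases "r \<le> m") auto
    have di: "d i < d (i + 1)" using small[of i "i + 1"] i by simp
    have dyr: "d y \<le> d r"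
      using di y r d_inj[of y "i + 1"] i kn by (cases "d y = d (i + 1)") (auto simp: y_def)
    have yr: "y \<le> r" using big[of r y] dyr rbig y by (cases "r < y") auto
    define z where "z = p (i + 1)"
    have z: "m + 2 \<le> z" "z \<le> n" "d z = Suc (d (i + 1))"
      using p_small[of "i + 1"] p_range[of "i + 1"] d_step[of "i + 1"] i kn by (auto simp: z_def)
    \<comment> \<open>Otherwise p y is large, because the small entries before i + 1 come no later
      than i. Then p y <= r < z, and the places i + 1 < y < r carry z > p y > i + 1.\<close>
    have req: "r = y"
    proof (rule ccontr)
      assume "r \<noteq> y"
      hence lt: "y < r" using yr by simp
      have "p y \<noteq> 1" using p_inj[of y "m + 1"] m i by (auto simp: y_def)
      hence py: "d (p y) = Suc (d y)" "1 \<le> p y" "p y \<le> n"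
        using d_step[of y] p_range[of y] y by (auto simp: y_def)
      have "d y < d r" using big[of y r] lt r i by (simp add: y_def)
      hence dpy: "d (p y) \<le> d r" using py by simp
      have "m + 2 \<le> p y"
      proof (rule ccontr)
        assume "\<not> m + 2 \<le> p y"
        hence "p y \<le> i" using not_between[of "p y" i] dpy r py i by simp
        hence "d (p y) \<le> d i" using small[of "p y" i] py i by (cases "p y = i") auto
        thus False using py y by simp
      qed
      moreover have "p y \<le> r" using big[of r "p y"] dpy rbig py by (cases "r < p y") auto
      moreover have "r < z" using big[of z r] z r by (cases "z = r"; cases "z < r") auto
      ultimately show False
        using p_321[of r y "i + 1"] r lt i by (simp add: y_def z_def)
    qed
    have yz: "y < z" using big[of z y] z r req y by (cases "z = y"; cases "z < y") auto
    \<comment> \<open>Otherwise y + 1 lies between y and z in the cycle, where only i + 1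
      stands.\<close>
    have "z = y + 1"
    proof (rule ccontr)
      assume "z \<noteq> y + 1"
      hence "y + 1 < z" using yz by simp
      hence "d y < d (y + 1)" "d (y + 1) < d z"
        using big[of y "y + 1"] big[of "y + 1" z] z i by (auto simp: y_def)
      hence "d (y + 1) = d (i + 1)" using z r req by simp
      thus False using d_inj[of "y + 1" "i + 1"] \<open>y + 1 < z\<close> z i kn by (simp add: y_def)
    qed
    thus ?thesis using req r by (simp add: y_def z_def)
  qed
  have p_le: "p i = m + 1 + i" if "1 \<le> i" "i \<le> m" for i
    using that
  proof (induction i rule: dec_induct)
    case base
    show ?case using m by simp
  next
    case (step i)
    thus ?case using adv[of i] by simp
  qed
  have p_mid: "p (m + 1 + i) = i + 1" if "1 \<le> i" "i < m" for i
    using adv[of i] p_le[of i] that by simp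
  have nm: "2 * m + 1 \<le> n" using p_le[of m] p_range[of m] m kn by simp
  have dm: "d (2 * m + 1) = Suc (d m)" using d_step[of m] p_le[of m] m kn by (simp add: mult_2)
  \<comment> \<open>All of 1, ..., m come before 2m + 1, the successor of m, so from there on only
    large entries and m + 1 can follow.\<close>
  have p_tail: "d (p j) = Suc (d j)" "m < p j" if "2 * m + 1 \<le> j" "j \<le> n" for j
  proof -
    have "p j \<noteq> 1" using p_inj[of j "m + 1"] m that by auto
    thus 1: "d (p j) = Suc (d j)" using d_step[of j] that by simp
    have "d (2 * m + 1) \<le> d j" using big[of "2 * m + 1" j] that m by (cases "j = 2 * m + 1") auto
    thus "m < p j" using 1 dm small[of "p j" m] p_range[of j] that
      by (cases "p j = m"; cases "p j < m") auto
  qed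
  have p_next: "p j = j + 1" if j: "2 * m + 1 \<le> j" "j < n" for j
  proof -
    have dj: "d j < d (j + 1)" using big[of j "j + 1"] j m by simp
    have "p j \<noteq> m + 1"
      using p_tail[of j] dlast[of "j + 1"] dj j by auto
    hence pj: "m + 2 \<le> p j" using p_tail[of j] j by simp
    have "j < p j" using big[of "p j" j] pj p_tail[of j] j by (cases "p j = j"; cases "p j < j") auto
    moreover have "\<not> j + 1 < p j"
      using big[of "j + 1" "p j"] dj p_tail[of j] p_range[of j] j m by auto
    ultimately show ?thesis by simp
  qed
  have p_n: "p n = m + 1"
  proof (rule ccontr)
    assume "p n \<noteq> m + 1"
    hence "m + 2 \<le> p n" using p_tail[of n] nm by simp
    thus False using big[of "p n" n] p_tail[of n] nm p_range[of n] n_pos by (cases "p n = n") auto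
  qed
  have "p v = stair n m v" for v
  proof (cases "v = 0 \<or> n < v")
    case True
    hence "v \<notin> {1..n}" by auto
    thus ?thesis using permutes_not_in[OF perm, of v] True by (auto simp: stair_def)
  next
    case False
    consider "v \<le> m" | "v = m + 1" | "m + 1 < v" "v \<le> 2 * m" | "2 * m + 1 \<le> v" "v < n" | "v = n"
      using False by linarith
    thus ?thesis
    proof cases
      case 3
      thus ?thesis using p_mid[of "v - (m + 1)"] False by (simp add: stair_def)
    qed (use False p_le[of v] m p_next[of v] p_n nm in \<open>auto simp: stair_def\<close>)
  qed
  thus ?thesis using nm by auto
qed

section \<open>Prepending 1 to the cycle\<close>

text \<open>Increments the cycle notation of \<open>q\<close> and puts \<open>1\<close> in front.\<close>

definition lift1 :: "(nat \<Rightarrow> nat) \<Rightarrow> nat \<Rightarrow> nat" where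
  "lift1 q v = (if v = 0 then 0 else if v = 1 then 2 else if q (v - 1) = 1 then 1 else q (v - 1) + 1)"

text \<open>The new place 1 cannot start a 321: its value 2 exceeds only one value, and its position
  is 0. All other places keep their relative order, the value 1 still marking the end of the
  cycle.\<close>

lemma avoider_lift1:
  assumes "avoider m q d"
  shows "avoider (m + 1) (lift1 q) (\<lambda>v. if v \<le> 1 then 0 else d (v - 1) + 1)"
proof -
  interpret avoider m q d by fact
  have q_out: "q v = v" if "m < v" for v using permutes_not_in[OF perm, of v] that by simp
  have mono: "q (u - 1) < q (v - 1)" if "2 \<le> u" "u \<le> m + 1" "lift1 q u < lift1 q v" "2 \<le> v" "v \<le> m + 1" for u v
    using that p_range[of "u - 1"] p_range[of "v - 1"] by (auto simp: lift1_def split: if_splits)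
  have range: "1 \<le> lift1 q v \<and> lift1 q v \<le> m + 1" if "1 \<le> v" "v \<le> m + 1" for v
    using that p_range[of "v - 1"] n_pos by (auto simp: lift1_def)
  show ?thesis
  proof
    show "1 \<le> m + 1" by simp
    show "lift1 q permutes {1..m + 1}"
    proof (rule permutes_intervalI)
      fix v assume v: "v = 0 \<or> m + 1 < v"
      have "q (v - 1) = v - 1" if "m + 1 < v" using q_out[of "v - 1"] that by linarith
      thus "lift1 q v = v" using v n_pos by (auto simp: lift1_def)
    next
      fix u v assume "1 \<le> u" "u < v" "v \<le> m + 1"
      moreover from this have "q (u - 1) \<noteq> q (v - 1)" using p_inj[of "u - 1" "v - 1"] by linarith
      moreover have "0 < q (w - 1)" if "2 \<le> w" "w \<le> m + 1" for w using that p_range[of "w - 1"] by fastforce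
      ultimately show "lift1 q u \<noteq> lift1 q v" by (simp add: lift1_def)
    qed (use range in blast)
    show "(if (1::nat) \<le> 1 then 0 else d (1 - 1) + 1) = 0" by simp
  next
    fix v assume v: "1 \<le> v" "v \<le> m + 1" "lift1 q v \<noteq> 1"
    show "(if lift1 q v \<le> 1 then 0 else d (lift1 q v - 1) + 1) = Suc (if v \<le> 1 then 0 else d (v - 1) + 1)"
    proof (cases "v = 1")
      case True
      thus ?thesis using d1 by (simp add: lift1_def)
    next
      case False
      hence "1 \<le> v - 1" "v - 1 \<le> m" "v \<noteq> 1" using v by linarith+
      thus ?thesis using v p_range[of "v - 1"] d_step[of "v - 1"] by (auto simp: lift1_def)
    qed
  next
    show "no321 (m + 1) (lift1 q)"
      unfolding no321_def
    proof (intro notI, elim exE conjE)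
      fix x y z assume h: "1 \<le> x" "x < y" "y < z" "z \<le> m + 1"
        "lift1 q y < lift1 q x" "lift1 q z < lift1 q y"
      have "lift1 q 1 = 2" by (simp add: lift1_def)
      hence "x \<noteq> 1" using h range[of y] range[of z] by auto
      hence "x - 1 < y - 1" "y - 1 < z - 1" "1 \<le> x - 1" "z - 1 \<le> m" using h by linarith+
      thus False using p_321[of "z - 1" "y - 1" "x - 1"] mono[of y x] mono[of z y] h by auto
    qed
    show "no321 (m + 1) (\<lambda>v. if v \<le> 1 then 0 else d (v - 1) + 1)"
      unfolding no321_def
    proof (intro notI, elim exE conjE)
      fix x y z :: nat assume h: "1 \<le> x" "x < y" "y < z" "z \<le> m + 1"
        "(if y \<le> 1 then 0 else d (y - 1) + 1) < (if x \<le> 1 then 0 else d (x - 1) + 1)"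
        "(if z \<le> 1 then 0 else d (z - 1) + 1) < (if y \<le> 1 then 0 else d (y - 1) + 1)"
      hence "d (z - 1) < d (y - 1)" "d (y - 1) < d (x - 1)" "x \<noteq> 1" by (auto split: if_splits)
      moreover from this have "x - 1 < y - 1" "y - 1 < z - 1" "1 \<le> x - 1" "z - 1 \<le> m" using h by linarith+
      ultimately show False using d_321[of "z - 1" "y - 1" "x - 1"] by simp
    qed
  qed
qed

lemma avoider_unlift1:
  assumes "avoider (m + 1) p d" "1 \<le> m" "p 1 = 2"
  shows "\<exists>q e. avoider m q e \<and> p = lift1 q"
proof -
  interpret avoider "m + 1" p d by fact
  define q where "q v = (if v = 0 then 0 else if p (v + 1) = 1 then 1 else p (v + 1) - 1)" for v
  define e where "e v = d (v + 1) - 1" for v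
  have p0: "p 0 = 0" using permutes_not_in[OF perm, of 0] by simp
  \<comment> \<open>The value 2 is taken at 1, so lowering a value other than 1 never produces a
    second 1.\<close>
  have ne2: "p (v + 1) \<noteq> 2" if "1 \<le> v" for v using p_inj[of "v + 1" 1] assms that by auto
  have pge: "1 \<le> p (v + 1)" for v using p_inj[of "v + 1" 0] p0 by (cases "p (v + 1) = 0") auto
  have mono: "p (u + 1) < p (v + 1)" if "q u < q v" "1 \<le> u" "1 \<le> v" for u v
    using that pge[of u] pge[of v] by (auto simp: q_def split: if_splits)
  have "avoider m q e"
  proof
    show "1 \<le> m" by fact
    show "q permutes {1..m}"
    proof (rule permutes_intervalI)
      fix v assume "1 \<le> v" "v \<le> m"
      thus "1 \<le> q v \<and> q v \<le> m" using p_range[of "v + 1"] assms(2) by (auto simp: q_def)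
    next
      fix u v assume "1 \<le> u" "u < v" "v \<le> m"
      hence "p (u + 1) \<noteq> p (v + 1)" using p_inj[of "u + 1" "v + 1"] by auto
      thus "q u \<noteq> q v" using \<open>1 \<le> u\<close> \<open>u < v\<close> ne2[of u] ne2[of v] pge[of u] pge[of v]
        unfolding q_def by (simp split: if_splits) linarith
    next
      fix v assume v: "v = 0 \<or> m < v"
      have "p (v + 1) = v + 1" if "m < v" using permutes_not_in[OF perm, of "v + 1"] that by simp
      thus "q v = v" using v by (auto simp: q_def)
    qed
    show "e 1 = 0" using d_step[of 1] assms d1 by (simp add: e_def numeral_2_eq_2)
  next
    fix v assume v: "1 \<le> v" "v \<le> m" "q v \<noteq> 1"
    hence "p (v + 1) \<noteq> 1" by (auto simp: q_def)
    thus "e (q v) = Suc (e v)"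
      using d_step[of "v + 1"] d_pos[of "v + 1"] v pge[of v] by (auto simp: q_def e_def)
  next
    show "no321 m q"
      unfolding no321_def
    proof (intro notI, elim exE conjE)
      fix x y z assume h: "1 \<le> x" "x < y" "y < z" "z \<le> m" "q y < q x" "q z < q y"
      thus False using p_321[of "z + 1" "y + 1" "x + 1"] mono[of z y] mono[of y x] by auto
    qed
    show "no321 m e"
      unfolding no321_def
    proof (intro notI, elim exE conjE)
      fix x y z assume h: "1 \<le> x" "x < y" "y < z" "z \<le> m" "e y < e x" "e z < e y"
      hence "d (z + 1) < d (y + 1)" "d (y + 1) < d (x + 1)" by (auto simp: e_def)
      thus False using d_321[of "z + 1" "y + 1" "x + 1"] h by auto
    qed
  qed
  moreover have "p v = lift1 q v" for v
  proof (cases "v \<le> 1")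
    case True
    hence "v = 0 \<or> v = 1" by auto
    thus ?thesis using p0 assms(3) by (auto simp: lift1_def)
  next
    case False
    hence "1 \<le> v - 1" "v - 1 + 1 = v" by linarith+
    thus ?thesis using False ne2[of "v - 1"] pge[of "v - 1"] by (auto simp: lift1_def q_def)
  qed
  ultimately show ?thesis by blast
qed

section \<open>Inserting 1 and 2 into the cycle\<close>

text \<open>
  Adds 2 to the entries of the cycle notation of \<open>q\<close>, puts \<open>1\<close> in front and \<open>2\<close>
  immediately before the \<open>4\<close>.
\<close>

definition lift2 :: "(nat \<Rightarrow> nat) \<Rightarrow> nat \<Rightarrow> nat" where
  "lift2 q v = (if v = 0 then 0 else if v \<le> 2 then v + 2
     else if q (v - 2) \<le> 2 then q (v - 2) else q (v - 2) + 2)"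

text \<open>\<open>d 2\<close> is the position of the old 2, which becomes 4. The new 1 pushes every
  entry by one, and the new 2 pushes 4 and all later entries once more.\<close>

definition lift2_pos :: "(nat \<Rightarrow> nat) \<Rightarrow> nat \<Rightarrow> nat" where
  "lift2_pos d v = (if v \<le> 1 then 0 else if v = 2 then d 2 + 1
     else if d (v - 2) < d 2 then d (v - 2) + 1 else d (v - 2) + 2)"

text \<open>A 321 beyond the new places pulls back to \<open>q\<close> or \<open>d\<close>. One in
  the permutation starting at a place up to 2 must continue with the values 2, 1, and place 1 of
  \<open>q\<close> can start it instead, by \<open>3 \<le> q 1\<close>. One in the positions
  starting at 2 can start at the old 2 instead.\<close>

lemma avoider_lift2:
  assumes "avoider m q d" "3 \<le> q 1"
  shows "avoider (m + 2) (lift2 q) (lift2_pos d)"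
proof -
  interpret avoider m q d by fact
  have m3: "3 \<le> m" using p_range[of 1] n_pos assms(2) by simp
  have q_out: "q v = v" if "m < v" for v using permutes_not_in[OF perm, of v] that by simp
  have range: "1 \<le> lift2 q v \<and> lift2 q v \<le> m + 2" if "1 \<le> v" "v \<le> m + 2" for v
    using that p_range[of "v - 2"] m3 by (auto simp: lift2_def)
  have val: "lift2 q v \<noteq> 3" "lift2 q v \<noteq> 4" if "3 \<le> v" for v
    using that by (auto simp: lift2_def)
  have mono: "q (u - 2) < q (v - 2)" if "3 \<le> u" "lift2 q u < lift2 q v" "3 \<le> v" for u v
    using that by (auto simp: lift2_def split: if_splits)
  have dmono: "d (u - 2) < d (v - 2)" if "3 \<le> u" "lift2_pos d u < lift2_pos d v" "3 \<le> v" for u v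
    using that by (auto simp: lift2_pos_def split: if_splits)
  show ?thesis
  proof
    show "1 \<le> m + 2" by simp
    show "lift2 q permutes {1..m + 2}"
    proof (rule permutes_intervalI)
      fix v assume v: "v = 0 \<or> m + 2 < v"
      have "q (v - 2) = v - 2" if "m + 2 < v" using q_out[of "v - 2"] that by linarith
      thus "lift2 q v = v" using v m3 by (auto simp: lift2_def)
    next
      fix u v assume uv: "1 \<le> u" "u < v" "v \<le> m + 2"
      consider "v \<le> 2" | "u \<le> 2" "3 \<le> v" | "3 \<le> u" using uv by linarith
      thus "lift2 q u \<noteq> lift2 q v"
      proof cases
        case 1
        thus ?thesis using uv by (simp add: lift2_def)
      next
        case 2
        hence "lift2 q u \<in> {3, 4}" using uv by (auto simp: lift2_def)
        thus ?thesis using val[of v] 2 by auto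
      next
        case 3
        thus ?thesis using p_inj[of "u - 2" "v - 2"] uv by (auto simp: lift2_def)
      qed
    qed (use range in blast)
    show "lift2_pos d 1 = 0" by (simp add: lift2_pos_def)
  next
    fix v assume v: "1 \<le> v" "v \<le> m + 2" "lift2 q v \<noteq> 1"
    have d2: "0 < d 2" using d_pos[of 2] m3 by simp
    have w: "q (v - 2) \<noteq> 1" "1 \<le> q (v - 2)" if "3 \<le> v"
    proof -
      have "1 \<le> v - 2" "v - 2 \<le> m" using v that by linarith+
      thus "1 \<le> q (v - 2)" using p_range by blast
      show "q (v - 2) \<noteq> 1" using v that by (auto simp: lift2_def)
    qed
    consider "v = 1" | "v = 2" | "3 \<le> v" "q (v - 2) = 2" | "3 \<le> v" "3 \<le> q (v - 2)"
      using v w by linarith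
    thus "lift2_pos d (lift2 q v) = Suc (lift2_pos d v)"
    proof cases
      case 1
      thus ?thesis using d1 d2 by (simp add: lift2_def lift2_pos_def)
    next
      case 2
      thus ?thesis by (simp add: lift2_def lift2_pos_def)
    next
      case 3
      thus ?thesis using d_step[of "v - 2"] v by (simp add: lift2_def lift2_pos_def)
    next
      case 4
      have "d (q (v - 2)) \<noteq> d 2"
        using d_inj[of "q (v - 2)" 2] p_range[of "v - 2"] 4 v m3 by auto
      thus ?thesis using d_step[of "v - 2"] v 4 by (auto simp: lift2_def lift2_pos_def)
    qed
  next
    show "no321 (m + 2) (lift2 q)"
      unfolding no321_def
    proof (intro notI, elim exE conjE)
      fix x y z assume h: "1 \<le> x" "x < y" "y < z" "z \<le> m + 2"
        "lift2 q y < lift2 q x" "lift2 q z < lift2 q y"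
      have y3: "3 \<le> y" using h by (cases "x = 1"; cases "y = 2") (auto simp: lift2_def)
      show False
      proof (cases "x \<le> 2")
        case True
        hence "lift2 q x \<le> 4" using h by (simp add: lift2_def)
        hence "lift2 q y = 2" "lift2 q z = 1" using h val[of y] y3 range[of y] range[of z] by auto
        hence "q (y - 2) = 2" "q (z - 2) = 1" using y3 h by (auto simp: lift2_def split: if_splits)
        moreover from this have "y - 2 \<noteq> 1" using assms(2) by auto
        ultimately have "1 < y - 2" using y3 by linarith
        moreover have "y - 2 < z - 2" "z - 2 \<le> m" using h y3 by linarith+
        ultimately show False
          using p_321[of "z - 2" "y - 2" 1] \<open>q (y - 2) = 2\<close> \<open>q (z - 2) = 1\<close> assms(2) by simp
      next
        case False
        hence "x - 2 < y - 2" "y - 2 < z - 2" "1 \<le> x - 2" "z - 2 \<le> m" using h by linarith+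
        thus False using p_321[of "z - 2" "y - 2" "x - 2"] mono[of y x] mono[of z y] h False by auto
      qed
    qed
    show "no321 (m + 2) (lift2_pos d)"
      unfolding no321_def
    proof (intro notI, elim exE conjE)
      fix x y z assume h: "1 \<le> x" "x < y" "y < z" "z \<le> m + 2"
        "lift2_pos d y < lift2_pos d x" "lift2_pos d z < lift2_pos d y"
      have x1: "x \<noteq> 1" using h by (auto simp: lift2_pos_def)
      show False
      proof (cases "x = 2")
        case True
        hence d: "d (y - 2) < d 2" "d (z - 2) < d (y - 2)"
          using h dmono[of z y] by (auto simp: lift2_pos_def split: if_splits)
        hence "y - 2 \<noteq> 1" "y - 2 \<noteq> 2" using d1 by auto
        hence "2 < y - 2" "y - 2 < z - 2" "z - 2 \<le> m" using h True by linarith+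
        thus False using d_321[of "z - 2" "y - 2" 2] d by simp
      next
        case False
        hence "x - 2 < y - 2" "y - 2 < z - 2" "1 \<le> x - 2" "z - 2 \<le> m" using h x1 by linarith+
        thus False using d_321[of "z - 2" "y - 2" "x - 2"] dmono[of y x] dmono[of z y] h x1 False by auto
      qed
    qed
  qed
qed

lemma avoider_unlift2:
  assumes "avoider (m + 2) p d" "1 \<le> m" "p 1 = 3" "p 2 = 4"
  shows "\<exists>q e. avoider m q e \<and> 3 \<le> q 1 \<and> p = lift2 q"
proof -
  interpret avoider "m + 2" p d by fact
  have m2: "2 \<le> m" using p_range[of 2] assms by simp
  define q where "q v = (if v = 0 then 0 else if p (v + 2) \<le> 2 then p (v + 2) else p (v + 2) - 2)" for v
  define e where "e v = (if d (v + 2) < d 2 then d (v + 2) - 1 else d (v + 2) - 2)" for v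
  have p0: "p 0 = 0" using permutes_not_in[OF perm, of 0] by simp
  \<comment> \<open>The values 3 and 4 are taken at 1 and 2. The remaining values are 1, 2 or at
    least 5, so lowering the latter by 2 keeps the order.\<close>
  have ne: "p (v + 2) \<noteq> 3" "p (v + 2) \<noteq> 4" if "1 \<le> v" for v
    using p_inj[of "v + 2" 1] p_inj[of "v + 2" 2] assms that by auto
  have pge: "1 \<le> p (v + 2)" for v using p_inj[of "v + 2" 0] p0 by (cases "p (v + 2) = 0") auto
  have mono: "p (u + 2) < p (v + 2)" if "q u < q v" "1 \<le> u" "1 \<le> v" for u v
    using that ne[of u] ne[of v] by (auto simp: q_def split: if_splits)
  have d3: "d 3 = 1" using d_step[of 1] assms d1 by simp
  have d2: "1 < d 2" using d_pos[of 2] d_inj[of 2 3] d3 m2 by (cases "d 2 = 1") auto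
  have d4: "d 4 = Suc (d 2)" using d_step[of 2] assms m2 by simp
  have dv: "0 < d (v + 2)" "d (v + 2) \<noteq> d 2" if "1 \<le> v" "v \<le> m" for v
    using d_pos[of "v + 2"] d_inj[of "v + 2" 2] that by auto
  have emono: "d (u + 2) < d (v + 2)" if "e u < e v" "1 \<le> u" "1 \<le> v" "u \<le> m" "v \<le> m" for u v
    using that dv[of u] dv[of v] by (auto simp: e_def split: if_splits)
  obtain l where l: "1 \<le> l" "l \<le> m + 2" "p l = 1" using pre[of 1] n_pos by auto
  \<comment> \<open>This and the next steps secure \<open>3 \<le> q 1\<close>. First, 3 is not last
    in the cycle, as it precedes 2; then p 3 = 2 would put 3 > 2 > 1 at the places 1 < 3 <
    l.\<close>
  have "p 3 \<noteq> 1" using d_le_last[of 3 2] d3 d2 m2 by auto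
  hence l4: "4 \<le> l" using l assms(3,4) by (cases "l = 1"; cases "l = 2"; cases "l = 3") auto
  have "p 3 \<noteq> 2" using p_321[of l 3 1] l l4 assms by auto
  hence p3: "5 \<le> p 3" using \<open>p 3 \<noteq> 1\<close> ne[of 1] pge[of 1] by (simp add: numeral_3_eq_3)
  have "avoider m q e"
  proof
    show "1 \<le> m" by fact
    show "q permutes {1..m}"
    proof (rule permutes_intervalI)
      fix v assume "1 \<le> v" "v \<le> m"
      thus "1 \<le> q v \<and> q v \<le> m" using p_range[of "v + 2"] m2 by (auto simp: q_def)
    next
      fix u v assume "1 \<le> u" "u < v" "v \<le> m"
      hence "p (u + 2) \<noteq> p (v + 2)" using p_inj[of "u + 2" "v + 2"] by auto
      thus "q u \<noteq> q v" using \<open>1 \<le> u\<close> \<open>u < v\<close> ne[of u] ne[of v]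
        unfolding q_def by (simp split: if_splits) linarith
    next
      fix v assume v: "v = 0 \<or> m < v"
      have "p (v + 2) = v + 2" if "m < v" using permutes_not_in[OF perm, of "v + 2"] that by simp
      thus "q v = v" using v by (auto simp: q_def)
    qed
    show "e 1 = 0" using d3 d2 by (simp add: e_def numeral_3_eq_3)
  next
    fix v assume v: "1 \<le> v" "v \<le> m" "q v \<noteq> 1"
    have pv: "p (v + 2) \<noteq> 1" using v by (auto simp: q_def)
    have ds: "d (p (v + 2)) = Suc (d (v + 2))" using d_step[of "v + 2"] pv v by simp
    show "e (q v) = Suc (e v)"
    proof (cases "p (v + 2) = 2")
      case True
      \<comment> \<open>With 2 deleted, its predecessor leads to its successor 4, which is renamed
        2.\<close>
      thus ?thesis using ds dv[of v] d4 v by (simp add: q_def e_def)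
    next
      case False
      hence p5: "5 \<le> p (v + 2)" using pv pge[of v] ne[of v] v by linarith
      hence "q v + 2 = p (v + 2)" using v by (simp add: q_def)
      moreover have "d (p (v + 2)) \<noteq> d 2"
        using d_inj[of "p (v + 2)" 2] p_range[of "v + 2"] p5 v by auto
      ultimately show ?thesis using ds dv[of v] d2 v by (auto simp: e_def)
    qed
  next
    show "no321 m q"
      unfolding no321_def
    proof (intro notI, elim exE conjE)
      fix x y z assume h: "1 \<le> x" "x < y" "y < z" "z \<le> m" "q y < q x" "q z < q y"
      thus False using p_321[of "z + 2" "y + 2" "x + 2"] mono[of z y] mono[of y x] by auto
    qed
    show "no321 m e"
      unfolding no321_def
    proof (intro notI, elim exE conjE)
      fix x y z assume h: "1 \<le> x" "x < y" "y < z" "z \<le> m" "e y < e x" "e z < e y"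
      thus False using d_321[of "z + 2" "y + 2" "x + 2"] emono[of z y] emono[of y x] by auto
    qed
  qed
  moreover have "3 \<le> q 1" using p3 by (simp add: q_def numeral_3_eq_3)
  moreover have "p v = lift2 q v" for v
  proof (cases "v \<le> 2")
    case True
    hence "v = 0 \<or> v = 1 \<or> v = 2" by auto
    thus ?thesis using p0 assms by (auto simp: lift2_def)
  next
    case False
    hence "v - 2 + 2 = v" "1 \<le> v - 2" by auto
    thus ?thesis using False ne[of "v - 2"] by (auto simp: lift2_def q_def)
  qed
  ultimately show ?thesis by blast
qed

section \<open>Counting\<close>

definition avoiders :: "nat \<Rightarrow> (nat \<Rightarrow> nat) set" where
  "avoiders n = {p. \<exists>d. avoider n p d}"

definition far_avoiders :: "nat \<Rightarrow> (nat \<Rightarrow> nat) set" where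
  "far_avoiders n = {p \<in> avoiders n. 3 \<le> p 1}"

lemma finite_avoiders: "finite (avoiders n)"
proof (rule finite_subset)
  show "avoiders n \<subseteq> {p. p permutes {1..n}}"
    by (auto simp: avoiders_def avoider_def cycle_pos_def)
qed (simp add: finite_permutations)

lemma avoiders_1: "avoiders 1 = {id}"
proof
  show "avoiders 1 \<subseteq> {id}"
    by (auto simp: avoiders_def avoider_def cycle_pos_def)
  have "avoider 1 id (\<lambda>_. 0)" by unfold_locales (auto simp: no321_def)
  thus "{id} \<subseteq> avoiders 1" by (auto simp: avoiders_def)
qed

lemma avoiders_pos:
  assumes "q \<in> avoiders m" "1 \<le> v"
  shows "1 \<le> q v"
proof -
  have q: "q permutes {1..m}" using assms by (auto simp: avoiders_def avoider_def cycle_pos_def)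
  show ?thesis
    using permutes_in_image[OF q, of v] permutes_not_in[OF q, of v] assms(2) by (cases "v \<le> m") auto
qed

lemma avoiders_0: "q \<in> avoiders m \<Longrightarrow> q 0 = 0"
  unfolding avoiders_def avoider_def cycle_pos_def
  by (auto dest: permutes_not_in[of _ _ 0])

lemma inj_on_lift1: "inj_on lift1 (avoiders m)"
proof (rule inj_onI, rule ext)
  fix q r v assume h: "q \<in> avoiders m" "r \<in> avoiders m" "lift1 q = lift1 r"
  show "q v = r v"
  proof (cases "v = 0")
    case True
    thus ?thesis using h(1,2)[THEN avoiders_0] by simp
  next
    case False
    \<comment> \<open>Positivity matters: the relabelling would send both 0 and 1 to 1.\<close>
    have "q v \<ge> 1" "r v \<ge> 1" using False avoiders_pos[OF h(1)] avoiders_pos[OF h(2)] by auto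
    moreover have "lift1 s (v + 1) = (if s v = 1 then 1 else s v + 1)" for s
      using False by (simp add: lift1_def)
    from this[of q] this[of r]
    have "(if q v = 1 then 1 else q v + 1) = (if r v = 1 then 1 else r v + 1)"
      unfolding h(3) by simp
    moreover have "a = b"
      if "1 \<le> a" "1 \<le> b" "(if a = 1 then 1 else a + 1) = (if b = 1 then 1 else b + 1)" for a b :: nat
      using that by presburger
    ultimately show ?thesis by blast
  qed
qed

lemma inj_on_lift2: "inj_on lift2 (avoiders m)"
proof (rule inj_onI, rule ext)
  fix q r v assume h: "q \<in> avoiders m" "r \<in> avoiders m" "lift2 q = lift2 r"
  show "q v = r v"
  proof (cases "v = 0")
    case True
    thus ?thesis using h(1,2)[THEN avoiders_0] by simp
  next
    case False
    have "lift2 s (v + 2) = (if s v \<le> 2 then s v else s v + 2)" for s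
      using False by (simp add: lift2_def)
    from this[of q] this[of r]
    have "(if q v \<le> 2 then q v else q v + 2) = (if r v \<le> 2 then r v else r v + 2)"
      unfolding h(3) by simp
    moreover have "a = b"
      if "(if a \<le> 2 then a else a + 2) = (if b \<le> 2 then b else b + 2)" for a b :: nat
      using that by presburger
    ultimately show ?thesis by blast
  qed
qed

lemma avoiders_Suc:
  assumes "1 \<le> m"
  shows "avoiders (m + 1) = lift1 ` avoiders m \<union> far_avoiders (m + 1)"
proof (intro equalityI subsetI)
  fix p assume p: "p \<in> avoiders (m + 1)"
  then obtain d where "avoider (m + 1) p d" by (auto simp: avoiders_def)
  then interpret avoider "m + 1" p d .
  \<comment> \<open>A fixed point 1 would be the last entry of the cycle, at position 0, although 2
    has a positive position.\<close>
  have "p 1 \<noteq> 1" using d_le_last[of 1 2] d_pos[of 2] d1 assms by auto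
  hence "p 1 = 2 \<or> 3 \<le> p 1" using p_range[of 1] by auto
  thus "p \<in> lift1 ` avoiders m \<union> far_avoiders (m + 1)"
  proof
    assume "p 1 = 2"
    thus ?thesis using avoider_unlift1[OF avoider_axioms assms] by (auto simp: avoiders_def)
  qed (use p in \<open>simp add: far_avoiders_def\<close>)
next
  fix p assume "p \<in> lift1 ` avoiders m \<union> far_avoiders (m + 1)"
  then consider q d where "p = lift1 q" "avoider m q d" | "p \<in> far_avoiders (m + 1)"
    by (auto simp: avoiders_def)
  thus "p \<in> avoiders (m + 1)"
  proof cases
    case 1
    thus ?thesis using avoider_lift1[OF 1(2)] unfolding avoiders_def by blast
  qed (simp add: far_avoiders_def)
qed

lemma card_avoiders_Suc:
  assumes "1 \<le> m"
  shows "card (avoiders (m + 1)) = card (avoiders m) + card (far_avoiders (m + 1))"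
proof -
  have "lift1 ` avoiders m \<inter> far_avoiders (m + 1) = {}"
    by (auto simp: far_avoiders_def lift1_def)
  thus ?thesis
    using card_Un_disjoint[of "lift1 ` avoiders m" "far_avoiders (m + 1)"] finite_avoiders
      card_image[OF inj_on_lift1, of m] avoiders_Suc[OF assms]
    by (simp add: far_avoiders_def)
qed

text \<open>This is the dichotomy as an equation of sets. The parameters of the stairs are exactly
  the k >= 1 with \<open>2 * k + 1 \<le> m + 2\<close>.\<close>

lemma far_avoiders_add_2:
  assumes "1 \<le> m"
  shows "far_avoiders (m + 2) = lift2 ` far_avoiders m \<union> stair (m + 2) ` {1..(m + 1) div 2}"
proof (intro equalityI subsetI)
  fix p assume "p \<in> far_avoiders (m + 2)"
  then obtain d where d: "avoider (m + 2) p d" and 3: "3 \<le> p 1"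
    by (auto simp: avoiders_def far_avoiders_def)
  interpret avoider "m + 2" p d by fact
  from dichotomy[OF 3] show "p \<in> lift2 ` far_avoiders m \<union> stair (m + 2) ` {1..(m + 1) div 2}"
  proof
    assume "p 1 = 3 \<and> p 2 = 4"
    thus ?thesis using avoider_unlift2[OF d assms] by (auto simp: avoiders_def far_avoiders_def)
  next
    assume a: "p (p 1 - 1) = 1"
    define k where "k = p 1 - 2"
    have "1 \<le> k" "p 1 = k + 2" "p (k + 1) = 1" using 3 a by (auto simp: k_def numeral_2_eq_2 Suc_diff_Suc)
    from eq_stair[OF this] \<open>1 \<le> k\<close> show ?thesis by auto
  qed
next
  fix p assume "p \<in> lift2 ` far_avoiders m \<union> stair (m + 2) ` {1..(m + 1) div 2}"
  thus "p \<in> far_avoiders (m + 2)"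
  proof
    assume "p \<in> lift2 ` far_avoiders m"
    then obtain q d where q: "p = lift2 q" "avoider m q d" "3 \<le> q 1"
      by (auto simp: far_avoiders_def avoiders_def)
    have "lift2 q 1 = 3" by (simp add: lift2_def)
    thus ?thesis using avoider_lift2[OF q(2,3)] q(1) unfolding far_avoiders_def avoiders_def by auto
  next
    assume "p \<in> stair (m + 2) ` {1..(m + 1) div 2}"
    then obtain k where k: "1 \<le> k" "2 * k + 1 \<le> m + 2" "p = stair (m + 2) k" by auto
    have "3 \<le> stair (m + 2) k 1" using k by (simp add: stair_def)
    thus ?thesis using avoider_stair[OF k(1,2)] k(3) unfolding far_avoiders_def avoiders_def by auto
  qed
qed

lemma card_far_avoiders_add_2:
  assumes "1 \<le> m"
  shows "card (far_avoiders (m + 2)) = card (far_avoiders m) + (m + 1) div 2"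
proof -
  have "inj_on (stair (m + 2)) {1..(m + 1) div 2}"
  proof (rule inj_onI)
    fix j k assume h: "j \<in> {1..(m + 1) div 2}" "k \<in> {1..(m + 1) div 2}"
      and eq: "stair (m + 2) j = stair (m + 2) k"
    have "stair (m + 2) i 1 = i + 2" if "i \<in> {1..(m + 1) div 2}" for i
      using that by (simp add: stair_def)
    from this[OF h(1)] this[OF h(2)] have "j + 2 = k + 2" unfolding eq by (rule trans[OF sym])
    thus "j = k" by simp
  qed
  hence 1: "card (stair (m + 2) ` {1..(m + 1) div 2}) = (m + 1) div 2" by (simp add: card_image)
  have 2: "card (lift2 ` far_avoiders m) = card (far_avoiders m)"
    by (rule card_image, rule inj_on_subset[OF inj_on_lift2[of m]]) (auto simp: far_avoiders_def)
  \<comment> \<open>A stair with value 3 at 1 has parameter 1 and sends 2 to 1, whereas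
    \<open>lift2\<close> sends 2 to 4.\<close>
  have "lift2 q \<noteq> stair (m + 2) k" if "k \<in> {1..(m + 1) div 2}" for q k
  proof
    assume "lift2 q = stair (m + 2) k"
    from fun_cong[OF this, of 1] fun_cong[OF this, of 2] that show False
      by (auto simp: lift2_def stair_def split: if_splits)
  qed
  hence "lift2 ` far_avoiders m \<inter> stair (m + 2) ` {1..(m + 1) div 2} = {}" by auto
  thus ?thesis
    unfolding far_avoiders_add_2[OF assms]
    using 1 2 finite_avoiders[of m] by (subst card_Un_disjoint) (auto simp: far_avoiders_def)
qed

lemma far_avoiders_empty: "n \<le> 2 \<Longrightarrow> far_avoiders n = {}"
proof -
  assume n: "n \<le> 2"
  have False if "avoider n p d" "3 \<le> p 1" for p d
    using that n permutes_in_image[of p "{1..n}" 1] by (auto simp: avoider_def cycle_pos_def)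
  thus ?thesis by (auto simp: far_avoiders_def avoiders_def)
qed

lemma card_far_avoiders: "1 \<le> n \<Longrightarrow> card (far_avoiders n) = (n + 1) div 2 choose 2"
proof (induction n rule: less_induct)
  case (less n)
  show ?case
  proof (cases "n \<le> 2")
    case True
    hence "n = 1 \<or> n = 2" using less.prems by auto
    thus ?thesis using far_avoiders_empty[of n] by auto
  next
    case False
    define m where "m = n - 2"
    have m: "n = m + 2" "1 \<le> m" using False by (auto simp: m_def)
    have "(m + 3) div 2 = Suc ((m + 1) div 2)" by simp
    moreover have "card (far_avoiders n) = ((m + 1) div 2 choose 2) + (m + 1) div 2"
      using card_far_avoiders_add_2[OF m(2)] less.IH[of m] m by simp
    \<comment> \<open>Pascal's rule, to be used with a = (m + 1) div 2, the number of
      stairs.\<close>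
    moreover have "Suc a choose 2 = (a choose 2) + a" for a by (simp add: numeral_2_eq_2)
    ultimately show ?thesis using m by (simp add: add.commute)
  qed
qed

lemma card_avoiders:
  assumes "1 \<le> n"
  shows "card (avoiders n) =
    (if even n then 1 + 2 * ((n + 2) div 2 choose 3)
     else 1 + 2 * ((n + 1) div 2 choose 3) + ((n + 1) div 2 choose 2))"
  using assms
proof (induction n rule: dec_induct)
  case base
  show ?case by (simp add: avoiders_1 flip: One_nat_def)
next
  case (step n)
  have s: "card (avoiders (Suc n)) = card (avoiders n) + ((n + 2) div 2 choose 2)"
    using card_avoiders_Suc[of n] card_far_avoiders[of "n + 1"] step.hyps by simp
  show ?case
  proof (cases "even n")
    case True
    thus ?thesis using step.IH s by simp
  next
    case False
    then obtain j where j: "n = 2 * j + 1" by (auto elim: oddE)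
    \<comment> \<open>The added term doubles the summand (j + 1 choose 2) of the odd case, and
      Pascal's rule absorbs both copies into twice (j + 2 choose 3).\<close>
    have "(j + 2 choose 3) = (j + 1 choose 3) + (j + 1 choose 2)"
      by (simp add: numeral_3_eq_3 numeral_2_eq_2)
    thus ?thesis using step.IH s j by simp
  qed
qed

theorem theorem6p24:
  shows "num_cyc_avoiders 3 [3, 2, 1] [3, 2, 1] = 2 \<and>
    num_cyc_avoiders 4 [3, 2, 1] [3, 2, 1] = 3 \<and>
    (\<forall>n \<ge> 5. num_cyc_avoiders n [3, 2, 1] [3, 2, 1] =
       num_cyc_avoiders (n - 1) [3, 2, 1] [3, 2, 1] + (nat \<lceil>real n / 2\<rceil> choose 2)) \<and>
    (\<forall>n \<ge> 1. num_cyc_avoiders n [3, 2, 1] [3, 2, 1] =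
       (if even n then 1 + 2 * ((n + 2) div 2 choose 3)
        else 1 + 2 * ((n + 1) div 2 choose 3) + ((n + 1) div 2 choose 2)))"
proof -
  have num: "num_cyc_avoiders n [3, 2, 1] [3, 2, 1] = card (avoiders n)" if "1 \<le> n" for n
    using that cyc_avoiders_321[of n] by (simp add: num_cyc_avoiders_def avoiders_def)
  have ceil: "nat \<lceil>real n / 2\<rceil> = (n + 1) div 2" for n
  proof (cases "even n")
    case True
    then obtain j where "n = 2 * j" by (auto elim: evenE)
    thus ?thesis by simp
  next
    case False
    then obtain j where j: "n = 2 * j + 1" by (auto elim: oddE)
    have "\<lceil>real n / 2\<rceil> = int j + 1" unfolding j by (rule ceiling_unique) auto
    thus ?thesis using j by simp
  qed
  have "card (avoiders n) = card (avoiders (n - 1)) + (nat \<lceil>real n / 2\<rceil> choose 2)" if "5 \<le> n" for n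
    using card_avoiders_Suc[of "n - 1"] card_far_avoiders[of n] that ceil[of n] by simp
  moreover have "card (avoiders 3) = 2" "card (avoiders 4) = 3"
    using card_avoiders[of 3] card_avoiders[of 4] by simp_all
  ultimately show ?thesis using num card_avoiders by simp
qed

end
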